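(* Let $\{\mathbf{D}_j\}_{j=1}^n$ be a finite family of distributive lattices such that for each $j\in\{1,\dots,n\}$ there is a commutative BCK-algebra $\mathbf{A}_j$ with $\mathbf{D}_j\cong\mathcal{K}^\circ\mathrm{X}(\mathbf{A}_j)$ as lattices. Then the product lattice $\mathbf{P}=\prod_{j=1}^n\mathbf{D}_j$ is in the image of $\mathcal{K}^\circ\mathrm{X}$, i.e. there is a commutative BCK-algebra $\mathbf{A}$ with $\mathbf{P}\cong\mathcal{K}^\circ\mathrm{X}(\mathbf{A})$ as lattices.
   Context: A commutative BCK-algebra is an algebra $\mathbf{A}=\langle A;\cdot,0\rangle$ of type $(2,0)$ such that for all $x,y,z\in A$: $(x\cdot y)\cdot z=(x\cdot z)\cdot y$; $x\cdot(x\cdot y)=y\cdot(y\cdot x)$; $x\cdot x=0$; $x\cdot 0=x$. Put $x\wedge y:=y\cdot(y\cdot x)$. An ideal is a subset $I\subseteq A$ with $0\in I$ such that $x\cdot y\in I$ and $y\in I$ imply $x\in I$. An ideal $P$ is prime if $P\neq A$ and $x\wedge y\in P$ implies $x\in P$ or $y\in P$. The spectrum of $\mathbf{A}$ is the set $\mathrm{X}(\mathbf{A})$ of prime ideals of $\mathbf{A}$ with the topology whose open sets are exactly the sets $\sigma(I)=\{P\in\mathrm{X}(\mathbf{A})\mid I\not\subseteq P\}$, $I$ an ideal of $\mathbf{A}$. The compact open subsets of $\mathrm{X}(\mathbf{A})$ are closed under finite unions and pairwise intersections; ordered by inclusion they form a distributive lattice with $0$, denoted $\mathcal{K}^\circ\mathrm{X}(\mathbf{A})$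 ("compact" does not include Hausdorff). *)

theory Defs
  imports "HOL-Algebra.Lattice" "HOL-Analysis.Abstract_Topology"
begin

section \<open>Commutative BCK-algebras\<close>

record 'a bck = "'a partial_object" +
  bmul :: "'a \<Rightarrow> 'a \<Rightarrow> 'a"  (infixl \<open>\<cdot>\<index>\<close> 70)
  bzero :: 'a  (\<open>\<zero>\<index>\<close>)

locale commutative_bck =
  fixes A :: "('a, 'm) bck_scheme" (structure)
  assumes mul_closed: "\<lbrakk>x \<in> carrier A; y \<in> carrier A\<rbrakk> \<Longrightarrow> x \<cdot> y \<in> carrier A"
    and zero_closed: "\<zero> \<in> carrier A"
    and mul_right_comm: "\<lbrakk>x \<in> carrier A; y \<in> carrier A; z \<in> carrier A\<rbrakk>
          \<Longrightarrow> (x \<cdot> y) \<cdot> z = (x \<cdot> z) \<cdot> y"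
    and mul_mul_comm: "\<lbrakk>x \<in> carrier A; y \<in> carrier A\<rbrakk> \<Longrightarrow> x \<cdot> (x \<cdot> y) = y \<cdot> (y \<cdot> x)"
    and mul_self: "x \<in> carrier A \<Longrightarrow> x \<cdot> x = \<zero>"
    and mul_zero: "x \<in> carrier A \<Longrightarrow> x \<cdot> \<zero> = x"

definition bck_meet :: "('a, 'm) bck_scheme \<Rightarrow> 'a \<Rightarrow> 'a \<Rightarrow> 'a"
  where "bck_meet A x y = y \<cdot>\<^bsub>A\<^esub> (y \<cdot>\<^bsub>A\<^esub> x)"

definition bck_ideal :: "('a, 'm) bck_scheme \<Rightarrow> 'a set \<Rightarrow> bool"
  where "bck_ideal A I \<longleftrightarrow> I \<subseteq> carrier A \<and> \<zero>\<^bsub>A\<^esub> \<in> I \<and>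
    (\<forall>x\<in>carrier A. \<forall>y\<in>carrier A. x \<cdot>\<^bsub>A\<^esub> y \<in> I \<and> y \<in> I \<longrightarrow> x \<in> I)"

definition bck_prime_ideal :: "('a, 'm) bck_scheme \<Rightarrow> 'a set \<Rightarrow> bool"
  where "bck_prime_ideal A P \<longleftrightarrow> bck_ideal A P \<and> P \<noteq> carrier A \<and>
    (\<forall>x\<in>carrier A. \<forall>y\<in>carrier A. bck_meet A x y \<in> P \<longrightarrow> x \<in> P \<or> y \<in> P)"

section \<open>The spectrum and its compact open sets\<close>

definition bck_sigma :: "('a, 'm) bck_scheme \<Rightarrow> 'a set \<Rightarrow> 'a set set"
  where "bck_sigma A I = {P. bck_prime_ideal A P \<and> \<not> I \<subseteq> P}"

definition bck_spectrum :: "('a, 'm) bck_scheme \<Rightarrow> 'a set topology"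
  where "bck_spectrum A = topology (\<lambda>U. \<exists>I. bck_ideal A I \<and> U = bck_sigma A I)"

definition compact_opens :: "'p topology \<Rightarrow> 'p set gorder"
  where "compact_opens X =
    \<lparr>carrier = {U. openin X U \<and> compactin X U}, eq = (=), le = (\<subseteq>)\<rparr>"

section \<open>Lattices\<close>

locale distributive_lattice = Lattice.lattice +
  assumes meet_join_distrib: "\<lbrakk>x \<in> carrier L; y \<in> carrier L; z \<in> carrier L\<rbrakk>
    \<Longrightarrow> x \<sqinter> (y \<squnion> z) = (x \<sqinter> y) \<squnion> (x \<sqinter> z)"

text \<open>
  Both \<^const>\<open>join_pres\<close> and \<^const>\<open>meet_pres\<close> include that the two orders are lattices.
\<close>

definition lattice_isomorphic :: "('a, 'c) gorder_scheme \<Rightarrow> ('b, 'd) gorder_scheme \<Rightarrow> bool"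
  where "lattice_isomorphic L M \<longleftrightarrow>
    (\<exists>f. bij_betw f (carrier L) (carrier M) \<and> join_pres L M f \<and> meet_pres L M f)"

definition product_order :: "'i set \<Rightarrow> ('i \<Rightarrow> ('a, 'c) gorder_scheme) \<Rightarrow> ('i \<Rightarrow> 'a) gorder"
  where "product_order J D =
    \<lparr>carrier = (\<Pi>\<^sub>E j\<in>J. carrier (D j)), eq = (=), le = (\<lambda>x y. \<forall>j\<in>J. x j \<sqsubseteq>\<^bsub>D j\<^esub> y j)\<rparr>"

section \<open>The sets \<open>\<sigma>(I)\<close> form a topology\<close>

text \<open>
  This justifies the use of \<^const>\<open>topology\<close>, which is unspecified on families of sets that
  are not closed under finite intersections and arbitrary unions.
\<close>

context commutative_bck
begin

lemma zero_mul:
  assumes x: "x \<in> carrier A"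
  shows "\<zero> \<cdot> x = \<zero>"
proof -
  have z: "\<zero> \<cdot> (\<zero> \<cdot> x) = \<zero>"
    using mul_mul_comm[OF zero_closed x] by (simp add: mul_zero mul_self x)
  have "\<zero> \<cdot> x = (\<zero> \<cdot> (\<zero> \<cdot> x)) \<cdot> x"
    by (simp only: z)
  also have "\<dots> = (\<zero> \<cdot> x) \<cdot> (\<zero> \<cdot> x)"
    by (rule mul_right_comm) (simp_all add: x zero_closed mul_closed)
  also have "\<dots> = \<zero>"
    by (simp add: mul_self mul_closed zero_closed x)
  finally show ?thesis .
qed

lemma mul_mul_le:
  assumes "x \<in> carrier A" "y \<in> carrier A"
  shows "(y \<cdot> (y \<cdot> x)) \<cdot> y = \<zero>"
proof -
  have "(y \<cdot> (y \<cdot> x)) \<cdot> y = (y \<cdot> y) \<cdot> (y \<cdot> x)"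
    by (rule mul_right_comm) (simp_all add: assms mul_closed)
  then show ?thesis
    by (simp add: assms mul_self zero_mul mul_closed)
qed

lemma ideal_meet:
  assumes I: "bck_ideal A I" and xy: "x \<in> carrier A" "y \<in> carrier A" and "x \<in> I \<or> y \<in> I"
  shows "bck_meet A x y \<in> I"
proof -
  have c: "bck_meet A x y \<in> carrier A"
    using xy by (simp add: bck_meet_def mul_closed)
  have "bck_meet A x y \<cdot> y = \<zero>"
    using mul_mul_le[OF xy] by (simp add: bck_meet_def)
  moreover have "bck_meet A x y \<cdot> x = \<zero>"
    using mul_mul_le[OF xy(2,1)] by (simp add: bck_meet_def mul_mul_comm[OF xy])
  ultimately show ?thesis
    using I xy c \<open>x \<in> I \<or> y \<in> I\<close> unfolding bck_ideal_def by auto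
qed

lemma sigma_Int:
  assumes I: "bck_ideal A I" and J: "bck_ideal A J"
  shows "bck_sigma A I \<inter> bck_sigma A J = bck_sigma A (I \<inter> J)"
proof
  show "bck_sigma A I \<inter> bck_sigma A J \<subseteq> bck_sigma A (I \<inter> J)"
  proof
    fix P assume "P \<in> bck_sigma A I \<inter> bck_sigma A J"
    then obtain x y where P: "bck_prime_ideal A P"
      and x: "x \<in> I" "x \<notin> P" and y: "y \<in> J" "y \<notin> P"
      by (auto simp: bck_sigma_def)
    have xy: "x \<in> carrier A" "y \<in> carrier A"
      using x y I J by (auto simp: bck_ideal_def)
    have "bck_meet A x y \<in> I \<inter> J"
      using ideal_meet[OF I xy] ideal_meet[OF J xy] x y by blast
    moreover have "bck_meet A x y \<notin> P"
      using P x y xy unfolding bck_prime_ideal_def by blast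
    ultimately show "P \<in> bck_sigma A (I \<inter> J)"
      using P by (auto simp: bck_sigma_def)
  qed
  show "bck_sigma A (I \<inter> J) \<subseteq> bck_sigma A I \<inter> bck_sigma A J"
    by (auto simp: bck_sigma_def)
qed

lemma ideal_carrier: "bck_ideal A (carrier A)"
  by (auto simp: bck_ideal_def zero_closed)

lemma sigma_Union:
  assumes "\<And>I. I \<in> \<I> \<Longrightarrow> bck_ideal A I"
  shows "\<exists>J. bck_ideal A J \<and> \<Union> (bck_sigma A ` \<I>) = bck_sigma A J"
proof -
  define J where "J = \<Inter>{K. bck_ideal A K \<and> \<Union>\<I> \<subseteq> K}"
  have "\<Union>\<I> \<subseteq> carrier A"
    using assms by (auto simp: bck_ideal_def)
  then have "J \<subseteq> carrier A"
    using ideal_carrier by (auto simp: J_def)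
  then have J: "bck_ideal A J"
    unfolding bck_ideal_def[of A J]
  proof (intro conjI ballI impI)
    show "\<zero> \<in> J"
      by (simp add: J_def bck_ideal_def)
    fix x y assume xy: "x \<in> carrier A" "y \<in> carrier A" "x \<cdot> y \<in> J \<and> y \<in> J"
    have "x \<in> K" if "bck_ideal A K" "\<Union>\<I> \<subseteq> K" for K
    proof -
      have "x \<cdot> y \<in> K" "y \<in> K"
        using xy that by (auto simp: J_def)
      with \<open>bck_ideal A K\<close> xy(1,2) show ?thesis
        unfolding bck_ideal_def by blast
    qed
    then show "x \<in> J"
      by (simp add: J_def)
  qed
  have sub: "J \<subseteq> P \<longleftrightarrow> (\<forall>I\<in>\<I>. I \<subseteq> P)" if "bck_ideal A P" for P
  proof
    assume "J \<subseteq> P"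
    moreover have "\<Union>\<I> \<subseteq> J"
      unfolding J_def by (rule Inter_greatest) simp
    ultimately show "\<forall>I\<in>\<I>. I \<subseteq> P"
      by blast
  next
    assume "\<forall>I\<in>\<I>. I \<subseteq> P"
    then have "P \<in> {K. bck_ideal A K \<and> \<Union>\<I> \<subseteq> K}"
      using that by (simp add: Union_least)
    then show "J \<subseteq> P"
      unfolding J_def by (rule Inter_lower)
  qed
  have "P \<in> \<Union> (bck_sigma A ` \<I>) \<longleftrightarrow> P \<in> bck_sigma A J" for P
  proof (cases "bck_prime_ideal A P")
    case True
    then have "bck_ideal A P"
      by (simp add: bck_prime_ideal_def)
    with True show ?thesis
      by (simp add: bck_sigma_def sub)
  qed (simp add: bck_sigma_def)
  then show ?thesis
    using J by blast
qed

lemma istopology_sigma: "istopology (\<lambda>U. \<exists>I. bck_ideal A I \<and> U = bck_sigma A I)"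
  unfolding istopology_def
proof (intro conjI allI impI)
  fix S T
  assume "\<exists>I. bck_ideal A I \<and> S = bck_sigma A I" "\<exists>I. bck_ideal A I \<and> T = bck_sigma A I"
  then obtain I J where IJ: "bck_ideal A I" "bck_ideal A J" "S = bck_sigma A I" "T = bck_sigma A J"
    by blast
  then have "bck_ideal A (I \<inter> J)"
    by (auto simp: bck_ideal_def)
  then show "\<exists>I. bck_ideal A I \<and> S \<inter> T = bck_sigma A I"
    using IJ sigma_Int by auto
next
  fix \<U>
  assume "\<forall>U\<in>\<U>. \<exists>I. bck_ideal A I \<and> U = bck_sigma A I"
  then obtain f where f: "\<forall>U\<in>\<U>. bck_ideal A (f U) \<and> U = bck_sigma A (f U)"
    by (auto dest: bchoice)
  then have "\<Union>\<U> = \<Union> (bck_sigma A ` (f ` \<U>))"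
    by (simp add: image_image)
  moreover have "bck_ideal A I" if "I \<in> f ` \<U>" for I
    using that f by auto
  ultimately show "\<exists>I. bck_ideal A I \<and> \<Union>\<U> = bck_sigma A I"
    using sigma_Union[of "f ` \<U>"] by simp
qed

lemma openin_spectrum:
  "openin (bck_spectrum A) U \<longleftrightarrow> (\<exists>I. bck_ideal A I \<and> U = bck_sigma A I)"
  by (simp add: bck_spectrum_def istopology_sigma)

lemma topspace_spectrum: "topspace (bck_spectrum A) = {P. bck_prime_ideal A P}"
proof -
  have "bck_sigma A (carrier A) = {P. bck_prime_ideal A P}"
    by (auto simp: bck_sigma_def bck_prime_ideal_def bck_ideal_def)
  then have "openin (bck_spectrum A) {P. bck_prime_ideal A P}"
    using ideal_carrier unfolding openin_spectrum by metis
  moreover have "U \<subseteq> {P. bck_prime_ideal A P}" if "openin (bck_spectrum A) U" for U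
    using that by (auto simp: openin_spectrum bck_sigma_def)
  ultimately show ?thesis
    by (meson openin_subset openin_topspace subset_antisym)
qed

end

end

theory Submission
  imports Defs "HOL-Library.Disjoint_Sets"
begin

text \<open>
  The algebra that realises the product lattice is the direct product of the given algebras. The
  reason is that a finite product of commutative BCK-algebras has as its spectrum the disjoint
  union of the spectra of the factors, and that a compact open set of a finite disjoint union is
  the same thing as a choice of one compact open set in each summand.

  Two facts carry the first half. An ideal of the product is determined by its traces on the
  factors (\<open>mem_ideal_iff_components\<close>): multiplying an element on the right by its part at one
  index erases that index, so after finitely many such steps \<open>\<zero>\<close> remains, and an ideal can undo
  each step. Secondly, two elements supported at different indices have meet \<open>\<zero>\<close>, so a prime ideal
  can be proper at one index only, and it is the inverse image of a prime ideal of that factor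
  under the projection (\<open>prime_ideal_is_cylinder\<close>). Taking inverse images under the projections is
  therefore a family of continuous injective open maps from the spectra of the factors whose images
  partition the spectrum of the product.

  The second half is pure topology (\<open>compact_opens_open_partition\<close>): the pieces of a partition into
  open sets are also closed, so a compact open set meets each of them in a compact open set, and
  conversely finitely many compact open sets have a compact open union. For the empty family the
  product is the algebra with one element: it has no prime ideals, and its only compact open set is
  the empty one.

  All isomorphisms are built as order isomorphisms, since the order determines joins and meets. In
  this form the lattice axioms of the set of compact open sets do not have to be checked: they are
  transferred from the given lattices.
\<close>

section \<open>Lattice isomorphisms as order isomorphisms\<close>

text \<open>
  The equivalences describe \<open>s\<close> as a supremum or infimum by all comparisons with \<open>s\<close>, a form that
  passes through products and order isomorphisms by rewriting alone.
\<close>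

lemma latticeI_bounds:
  assumes "partial_order L"
    and sup: "\<And>x y. \<lbrakk>x \<in> carrier L; y \<in> carrier L\<rbrakk> \<Longrightarrow>
      \<exists>s\<in>carrier L. \<forall>z\<in>carrier L. s \<sqsubseteq>\<^bsub>L\<^esub> z \<longleftrightarrow> x \<sqsubseteq>\<^bsub>L\<^esub> z \<and> y \<sqsubseteq>\<^bsub>L\<^esub> z"
    and inf: "\<And>x y. \<lbrakk>x \<in> carrier L; y \<in> carrier L\<rbrakk> \<Longrightarrow>
      \<exists>s\<in>carrier L. \<forall>z\<in>carrier L. z \<sqsubseteq>\<^bsub>L\<^esub> s \<longleftrightarrow> z \<sqsubseteq>\<^bsub>L\<^esub> x \<and> z \<sqsubseteq>\<^bsub>L\<^esub> y"
  shows "Lattice.lattice L"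
proof -
  interpret partial_order L by fact
  show ?thesis
  proof
    fix x y assume xy: "x \<in> carrier L" "y \<in> carrier L"
    from sup[OF xy] obtain s where s: "s \<in> carrier L"
      and "\<forall>z\<in>carrier L. s \<sqsubseteq>\<^bsub>L\<^esub> z \<longleftrightarrow> x \<sqsubseteq>\<^bsub>L\<^esub> z \<and> y \<sqsubseteq>\<^bsub>L\<^esub> z" by blast
    then have "least L s (Upper L {x, y})"
      using xy le_refl[OF s] by (auto simp: least_def Upper_def)
    then show "\<exists>s. least L s (Upper L {x, y})" ..
  next
    fix x y assume xy: "x \<in> carrier L" "y \<in> carrier L"
    from inf[OF xy] obtain s where s: "s \<in> carrier L"
      and "\<forall>z\<in>carrier L. z \<sqsubseteq>\<^bsub>L\<^esub> s \<longleftrightarrow> z \<sqsubseteq>\<^bsub>L\<^esub> x \<and> z \<sqsubseteq>\<^bsub>L\<^esub> y" by blast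
    then have "greatest L s (Lower L {x, y})"
      using xy le_refl[OF s] by (auto simp: greatest_def Lower_def)
    then show "\<exists>s. greatest L s (Lower L {x, y})" ..
  qed
qed

lemma (in Lattice.lattice) join_le_iff:
  assumes "x \<in> carrier L" "y \<in> carrier L" "z \<in> carrier L"
  shows "x \<squnion> y \<sqsubseteq> z \<longleftrightarrow> x \<sqsubseteq> z \<and> y \<sqsubseteq> z"
  using assms by (meson join_closed join_le join_left join_right le_trans)

lemma (in Lattice.lattice) le_meet_iff:
  assumes "x \<in> carrier L" "y \<in> carrier L" "z \<in> carrier L"
  shows "z \<sqsubseteq> x \<sqinter> y \<longleftrightarrow> z \<sqsubseteq> x \<and> z \<sqsubseteq> y"
  using assms by (meson meet_closed meet_le meet_left meet_right le_trans)

text \<open>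
  From left to right, \<open>x \<sqsubseteq> y\<close> says that the join of \<open>x\<close> and \<open>y\<close> is \<open>y\<close>, and this is both preserved
  and reflected by an injective map that respects joins. Conversely, bounds are defined by the order
  alone, so \<open>f\<close> carries suprema and infima to such; in particular the target, only assumed to be a
  partial order, is a lattice.
\<close>

lemma lattice_isomorphic_iff_order_isomorphic:
  "lattice_isomorphic L M \<longleftrightarrow> Lattice.lattice L \<and> partial_order M \<and>
    (\<exists>f. bij_betw f (carrier L) (carrier M) \<and>
      (\<forall>x\<in>carrier L. \<forall>y\<in>carrier L. f x \<sqsubseteq>\<^bsub>M\<^esub> f y \<longleftrightarrow> x \<sqsubseteq>\<^bsub>L\<^esub> y))"
  (is "?iso \<longleftrightarrow> ?ord")
proof
  assume ?iso
  then obtain f where bij: "bij_betw f (carrier L) (carrier M)" and j: "join_pres L M f"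
    unfolding lattice_isomorphic_def by blast
  from j interpret L: Lattice.lattice L by (simp add: join_pres_def)
  from j interpret M: Lattice.lattice M by (simp add: join_pres_def)
  have "f x \<sqsubseteq>\<^bsub>M\<^esub> f y \<longleftrightarrow> x \<sqsubseteq>\<^bsub>L\<^esub> y" if xy: "x \<in> carrier L" "y \<in> carrier L" for x y
  proof -
    have "f x \<sqsubseteq>\<^bsub>M\<^esub> f y \<longleftrightarrow> f (x \<squnion>\<^bsub>L\<^esub> y) = f y"
      using j xy bij_betwE[OF bij] by (simp add: M.le_iff_meet join_pres_def)
    also have "\<dots> \<longleftrightarrow> x \<squnion>\<^bsub>L\<^esub> y = y"
      using bij_betw_imp_inj_on[OF bij] xy by (auto dest: inj_onD)
    finally show ?thesis
      by (simp add: L.le_iff_meet xy)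
  qed
  then show ?ord
    using bij L.lattice_axioms M.partial_order_axioms by blast
next
  assume ?ord
  then obtain f where lat: "Lattice.lattice L" and po: "partial_order M"
    and bij: "bij_betw f (carrier L) (carrier M)"
    and le: "\<And>x y. \<lbrakk>x \<in> carrier L; y \<in> carrier L\<rbrakk> \<Longrightarrow> f x \<sqsubseteq>\<^bsub>M\<^esub> f y \<longleftrightarrow> x \<sqsubseteq>\<^bsub>L\<^esub> y"
    by blast
  interpret L: Lattice.lattice L by fact
  interpret MP: partial_order M by fact
  have car: "carrier M = f ` carrier L"
    using bij by (simp add: bij_betw_imp_surj_on)
  have join: "f (x \<squnion>\<^bsub>L\<^esub> y) \<sqsubseteq>\<^bsub>M\<^esub> z \<longleftrightarrow> f x \<sqsubseteq>\<^bsub>M\<^esub> z \<and> f y \<sqsubseteq>\<^bsub>M\<^esub> z"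
    if "x \<in> carrier L" "y \<in> carrier L" "z \<in> carrier M" for x y z
    using that by (auto simp: car le L.join_le_iff)
  have meet: "z \<sqsubseteq>\<^bsub>M\<^esub> f (x \<sqinter>\<^bsub>L\<^esub> y) \<longleftrightarrow> z \<sqsubseteq>\<^bsub>M\<^esub> f x \<and> z \<sqsubseteq>\<^bsub>M\<^esub> f y"
    if "x \<in> carrier L" "y \<in> carrier L" "z \<in> carrier M" for x y z
    using that by (auto simp: car le L.le_meet_iff)
  have "Lattice.lattice M"
  proof (rule latticeI_bounds[OF po])
    fix u v assume "u \<in> carrier M" "v \<in> carrier M"
    then obtain x y where xy: "x \<in> carrier L" "y \<in> carrier L" "u = f x" "v = f y"
      by (auto simp: car)
    show "\<exists>s\<in>carrier M. \<forall>z\<in>carrier M. s \<sqsubseteq>\<^bsub>M\<^esub> z \<longleftrightarrow> u \<sqsubseteq>\<^bsub>M\<^esub> z \<and> v \<sqsubseteq>\<^bsub>M\<^esub> z"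
      by (rule bexI[of _ "f (x \<squnion>\<^bsub>L\<^esub> y)"]) (use xy join in \<open>auto simp: car\<close>)
    show "\<exists>s\<in>carrier M. \<forall>z\<in>carrier M. z \<sqsubseteq>\<^bsub>M\<^esub> s \<longleftrightarrow> z \<sqsubseteq>\<^bsub>M\<^esub> u \<and> z \<sqsubseteq>\<^bsub>M\<^esub> v"
      by (rule bexI[of _ "f (x \<sqinter>\<^bsub>L\<^esub> y)"]) (use xy meet in \<open>auto simp: car\<close>)
  qed
  then interpret M: Lattice.lattice M .
  have "f (x \<squnion>\<^bsub>L\<^esub> y) = f x \<squnion>\<^bsub>M\<^esub> f y" "f (x \<sqinter>\<^bsub>L\<^esub> y) = f x \<sqinter>\<^bsub>M\<^esub> f y"
    if xy: "x \<in> carrier L" "y \<in> carrier L" for x y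
  proof -
    have c: "f x \<in> carrier M" "f y \<in> carrier M" "f (x \<squnion>\<^bsub>L\<^esub> y) \<in> carrier M" "f (x \<sqinter>\<^bsub>L\<^esub> y) \<in> carrier M"
      using xy by (auto simp: car)
    show "f (x \<squnion>\<^bsub>L\<^esub> y) = f x \<squnion>\<^bsub>M\<^esub> f y"
      using c join[OF xy] M.join_le_iff[OF c(1,2)] by (meson M.join_closed MP.le_antisym MP.le_refl)
    show "f (x \<sqinter>\<^bsub>L\<^esub> y) = f x \<sqinter>\<^bsub>M\<^esub> f y"
      using c meet[OF xy] M.le_meet_iff[OF c(1,2)] by (meson M.meet_closed MP.le_antisym MP.le_refl)
  qed
  then show ?iso
    using bij lat M.lattice_axioms unfolding lattice_isomorphic_def join_pres_def meet_pres_def by blast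
qed

lemma lattice_isomorphic_trans:
  assumes "lattice_isomorphic L M" "lattice_isomorphic M N"
  shows "lattice_isomorphic L N"
proof -
  obtain f where f: "bij_betw f (carrier L) (carrier M)"
      "\<forall>x\<in>carrier L. \<forall>y\<in>carrier L. f x \<sqsubseteq>\<^bsub>M\<^esub> f y \<longleftrightarrow> x \<sqsubseteq>\<^bsub>L\<^esub> y"
    using assms(1) by (auto simp: lattice_isomorphic_iff_order_isomorphic)
  obtain g where g: "bij_betw g (carrier M) (carrier N)"
      "\<forall>x\<in>carrier M. \<forall>y\<in>carrier M. g x \<sqsubseteq>\<^bsub>N\<^esub> g y \<longleftrightarrow> x \<sqsubseteq>\<^bsub>M\<^esub> y"
    using assms(2) by (auto simp: lattice_isomorphic_iff_order_isomorphic)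
  have "bij_betw (g \<circ> f) (carrier L) (carrier N)"
    using f g by (blast intro: bij_betw_trans)
  moreover have "\<forall>x\<in>carrier L. \<forall>y\<in>carrier L. (g \<circ> f) x \<sqsubseteq>\<^bsub>N\<^esub> (g \<circ> f) y \<longleftrightarrow> x \<sqsubseteq>\<^bsub>L\<^esub> y"
    using f(2) g(2) bij_betwE[OF f(1)] by simp
  ultimately show ?thesis
    using assms unfolding lattice_isomorphic_iff_order_isomorphic by blast
qed

section \<open>Products of lattices\<close>

lemma partial_order_product:
  assumes "\<And>j. j \<in> J \<Longrightarrow> partial_order (D j)"
  shows "partial_order (product_order J D)"
proof -
  note po = partial_order.axioms(1)[OF assms]
  note refl = weak_partial_order.le_refl[OF po]
    and antisym = partial_order.le_antisym[OF assms]
    and trans = weak_partial_order.le_trans[OF po]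
  show ?thesis
  proof
    fix x y assume "x \<sqsubseteq>\<^bsub>product_order J D\<^esub> y" "y \<sqsubseteq>\<^bsub>product_order J D\<^esub> x"
      "x \<in> carrier (product_order J D)" "y \<in> carrier (product_order J D)"
    then have "x = y"
      by (intro PiE_ext[of x J "\<lambda>j. carrier (D j)" y])
        (auto simp: product_order_def PiE_iff intro: antisym)
    then show "x .=\<^bsub>product_order J D\<^esub> y"
      by (simp add: product_order_def)
  qed (auto simp: product_order_def PiE_iff intro: refl trans)
qed

lemma lattice_product:
  assumes "\<And>j. j \<in> J \<Longrightarrow> Lattice.lattice (D j)"
  shows "Lattice.lattice (product_order J D)"
proof (rule latticeI_bounds)
  show "partial_order (product_order J D)"
    using assms by (intro partial_order_product)
      (auto simp: Lattice.lattice_def upper_semilattice_def)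
  fix x y assume xy: "x \<in> carrier (product_order J D)" "y \<in> carrier (product_order J D)"
  then have c: "x j \<in> carrier (D j)" "y j \<in> carrier (D j)" if "j \<in> J" for j
    using that by (auto simp: product_order_def)
  have bounds: "x j \<squnion>\<^bsub>D j\<^esub> y j \<in> carrier (D j)" "x j \<sqinter>\<^bsub>D j\<^esub> y j \<in> carrier (D j)" if j: "j \<in> J" for j
  proof -
    interpret Lattice.lattice "D j"
      by (rule assms[OF j])
    show "x j \<squnion>\<^bsub>D j\<^esub> y j \<in> carrier (D j)" "x j \<sqinter>\<^bsub>D j\<^esub> y j \<in> carrier (D j)"
      using c[OF j] by (simp_all add: join_closed meet_closed)
  qed
  show "\<exists>s\<in>carrier (product_order J D). \<forall>z\<in>carrier (product_order J D).
      s \<sqsubseteq>\<^bsub>product_order J D\<^esub> z \<longleftrightarrow> x \<sqsubseteq>\<^bsub>product_order J D\<^esub> z \<and> y \<sqsubseteq>\<^bsub>product_order J D\<^esub> z"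
    by (rule bexI[of _ "\<lambda>j\<in>J. x j \<squnion>\<^bsub>D j\<^esub> y j"])
      (auto simp: product_order_def c bounds lattice.join_le_iff[OF assms] PiE_iff)
  show "\<exists>s\<in>carrier (product_order J D). \<forall>z\<in>carrier (product_order J D).
      z \<sqsubseteq>\<^bsub>product_order J D\<^esub> s \<longleftrightarrow> z \<sqsubseteq>\<^bsub>product_order J D\<^esub> x \<and> z \<sqsubseteq>\<^bsub>product_order J D\<^esub> y"
    by (rule bexI[of _ "\<lambda>j\<in>J. x j \<sqinter>\<^bsub>D j\<^esub> y j"])
      (auto simp: product_order_def c bounds lattice.le_meet_iff[OF assms] PiE_iff)
qed

lemma lattice_isomorphic_product:
  assumes "\<And>j. j \<in> J \<Longrightarrow> lattice_isomorphic (D j) (E j)"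
  shows "lattice_isomorphic (product_order J D) (product_order J E)"
proof -
  have "\<exists>g. bij_betw g (carrier (D j)) (carrier (E j)) \<and>
      (\<forall>x\<in>carrier (D j). \<forall>y\<in>carrier (D j). g x \<sqsubseteq>\<^bsub>E j\<^esub> g y \<longleftrightarrow> x \<sqsubseteq>\<^bsub>D j\<^esub> y)"
    if "j \<in> J" for j
    using assms[OF that] by (simp add: lattice_isomorphic_iff_order_isomorphic)
  then obtain g where g: "\<And>j. j \<in> J \<Longrightarrow> bij_betw (g j) (carrier (D j)) (carrier (E j))"
    and le: "\<And>j x y. \<lbrakk>j \<in> J; x \<in> carrier (D j); y \<in> carrier (D j)\<rbrakk> \<Longrightarrow>
      g j x \<sqsubseteq>\<^bsub>E j\<^esub> g j y \<longleftrightarrow> x \<sqsubseteq>\<^bsub>D j\<^esub> y"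
    by metis
  let ?F = "\<lambda>x. \<lambda>j\<in>J. g j (x j)"
  let ?G = "\<lambda>y. \<lambda>j\<in>J. inv_into (carrier (D j)) (g j) (y j)"
  have "bij_betw ?F (\<Pi>\<^sub>E j\<in>J. carrier (D j)) (\<Pi>\<^sub>E j\<in>J. carrier (E j))"
  proof (rule bij_betw_byWitness[of _ ?G])
    show "\<forall>x\<in>\<Pi>\<^sub>E j\<in>J. carrier (D j). ?G (?F x) = x"
      by (auto intro!: ext simp: PiE_iff extensional_def bij_betw_inv_into_left[OF g])
    show "\<forall>y\<in>\<Pi>\<^sub>E j\<in>J. carrier (E j). ?F (?G y) = y"
      by (auto intro!: ext simp: PiE_iff extensional_def bij_betw_inv_into_right[OF g])
    show "?F ` (\<Pi>\<^sub>E j\<in>J. carrier (D j)) \<subseteq> (\<Pi>\<^sub>E j\<in>J. carrier (E j))"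
      using bij_betwE[OF g] by (auto simp: PiE_iff)
    show "?G ` (\<Pi>\<^sub>E j\<in>J. carrier (E j)) \<subseteq> (\<Pi>\<^sub>E j\<in>J. carrier (D j))"
      using bij_betwE[OF bij_betw_inv_into[OF g]] by (auto simp: PiE_iff)
  qed
  moreover have "\<forall>x\<in>\<Pi>\<^sub>E j\<in>J. carrier (D j). \<forall>y\<in>\<Pi>\<^sub>E j\<in>J. carrier (D j).
      (\<forall>j\<in>J. ?F x j \<sqsubseteq>\<^bsub>E j\<^esub> ?F y j) \<longleftrightarrow> (\<forall>j\<in>J. x j \<sqsubseteq>\<^bsub>D j\<^esub> y j)"
    by (auto simp: le PiE_iff)
  moreover have "Lattice.lattice (product_order J D)" "partial_order (product_order J E)"
    using assms by (auto simp: lattice_isomorphic_iff_order_isomorphic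
      intro: lattice_product partial_order_product)
  ultimately show ?thesis
    unfolding lattice_isomorphic_iff_order_isomorphic
    by (intro conjI exI[of _ ?F]) (simp_all add: product_order_def)
qed

section \<open>Compact open sets of a finite disjoint union\<close>

lemma partial_order_compact_opens: "partial_order (compact_opens X)"
  by unfold_locales (auto simp: compact_opens_def)

text \<open>
  The assumptions say that \<open>Y\<close> is a disjoint union of the spaces \<open>X j\<close>, embedded by the maps \<open>f j\<close>.
  A compact open set of \<open>Y\<close> corresponds to the family of its inverse images. Finiteness of \<open>J\<close> makes
  the union of one compact set in each piece compact; for infinite \<open>J\<close> almost all members of the
  family would have to be empty.
\<close>

lemma compact_opens_open_partition:
  assumes fin: "finite J"
    and cont: "\<And>j. j \<in> J \<Longrightarrow> continuous_map (X j) Y (f j)"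
    and opn: "\<And>j. j \<in> J \<Longrightarrow> open_map (X j) Y (f j)"
    and inj: "\<And>j. j \<in> J \<Longrightarrow> inj_on (f j) (topspace (X j))"
    and disj: "disjoint_family_on (\<lambda>j. f j ` topspace (X j)) J"
    and cover: "topspace Y \<subseteq> (\<Union>j\<in>J. f j ` topspace (X j))"
    and lat: "\<And>j. j \<in> J \<Longrightarrow> Lattice.lattice (compact_opens (X j))"
  shows "lattice_isomorphic (product_order J (\<lambda>j. compact_opens (X j))) (compact_opens Y)"
proof -
  let ?C = "\<Pi>\<^sub>E j\<in>J. {U. openin (X j) U \<and> compactin (X j) U}"
  let ?F = "\<lambda>U. \<Union>j\<in>J. f j ` U j"
  let ?G = "\<lambda>V. \<lambda>j\<in>J. {x \<in> topspace (X j). f j x \<in> V}"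
  have sub: "U j \<subseteq> topspace (X j)" if "U \<in> ?C" "j \<in> J" for U j
    using PiE_mem[OF that] by (auto dest: openin_subset)
  have GF: "?G (?F U) = U" if U: "U \<in> ?C" for U
  proof
    fix j
    show "?G (?F U) j = U j"
    proof (cases "j \<in> J")
      case True
      have "x \<in> U j" if x: "x \<in> topspace (X j)" and i: "i \<in> J" "y \<in> U i" "f j x = f i y" for x i y
      proof -
        have y: "y \<in> topspace (X i)"
          using sub[OF U i(1)] i by blast
        have "i = j"
          using disj x y i True unfolding disjoint_family_on_def by blast
        with i y x inj[OF True] show ?thesis
          by (auto dest: inj_onD)
      qed
      then show ?thesis
        using True sub[OF U True] by auto
    qed (use U in \<open>simp add: PiE_iff extensional_def\<close>)
  qed
  have FG: "?F (?G V) = V" if "openin Y V" for V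
    using openin_subset[OF that] cover by fastforce
  have F: "openin Y (?F U) \<and> compactin Y (?F U)" if U: "U \<in> ?C" for U
  proof
    show "openin Y (?F U)"
      using PiE_mem[OF U] opn by (intro openin_Union) (auto simp: open_map_def)
    show "compactin Y (?F U)"
      using PiE_mem[OF U] cont fin by (intro compactin_Union) (auto intro: image_compactin)
  qed
  have G: "?G V \<in> ?C" if V: "openin Y V" "compactin Y V" for V
  proof (rule restrict_PiE_iff[THEN iffD2], intro ballI CollectI conjI)
    fix j assume j: "j \<in> J"
    let ?T = "f j ` topspace (X j)" and ?U = "{x \<in> topspace (X j). f j x \<in> V}"
    show "openin (X j) ?U"
      using cont[OF j] V(1) by (rule openin_continuous_map_preimage)
    \<comment> \<open>Each piece of the partition is also closed, its complement being the union of the others.\<close>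
    have top: "f i ` topspace (X i) \<subseteq> topspace Y" if "i \<in> J" for i
      using cont[OF that] by (rule continuous_map_image_subset_topspace)
    have "openin Y (\<Union>i\<in>J-{j}. f i ` topspace (X i))"
      using opn by (intro openin_Union) (auto simp: open_map_def)
    moreover have "topspace Y - ?T = (\<Union>i\<in>J-{j}. f i ` topspace (X i))"
      using cover top disj j unfolding disjoint_family_on_def by blast
    ultimately have "closedin Y ?T"
      using top[OF j] by (simp add: closedin_def)
    then have "compactin Y (?T \<inter> V)"
      using V(2) by (rule closed_Int_compactin)
    moreover have "f j ` ?U = ?T \<inter> V"
      by blast
    ultimately have "compactin (subtopology Y ?T) (f j ` ?U)"
      by (auto simp: compactin_subtopology)
    moreover have "homeomorphic_map (X j) (subtopology Y ?T) (f j)"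
      using injective_open_imp_embedding_map[OF cont[OF j] opn[OF j] inj[OF j]]
      by (simp add: embedding_map_def)
    ultimately show "compactin (X j) ?U"
      by (subst (asm) homeomorphic_map_compactness) auto
  qed
  have "bij_betw ?F ?C {V. openin Y V \<and> compactin Y V}"
  proof (rule bij_betw_byWitness[of _ ?G])
    show "\<forall>U\<in>?C. ?G (?F U) = U"
      using GF by blast
    show "\<forall>V\<in>{V. openin Y V \<and> compactin Y V}. ?F (?G V) = V"
      using FG by blast
    show "?F ` ?C \<subseteq> {V. openin Y V \<and> compactin Y V}"
      using F by blast
    show "?G ` {V. openin Y V \<and> compactin Y V} \<subseteq> ?C"
      using G by blast
  qed
  moreover have "?F U \<subseteq> ?F W \<longleftrightarrow> (\<forall>j\<in>J. U j \<subseteq> W j)" if "U \<in> ?C" "W \<in> ?C" for U W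
  proof
    assume "?F U \<subseteq> ?F W"
    moreover have "?G V j \<subseteq> ?G V' j" if "V \<subseteq> V'" for V V' j
      using that by (auto simp: restrict_def)
    ultimately have "?G (?F U) j \<subseteq> ?G (?F W) j" for j
      by blast
    then show "\<forall>j\<in>J. U j \<subseteq> W j"
      unfolding GF[OF that(1)] GF[OF that(2)] by blast
  qed blast
  ultimately show ?thesis
    unfolding lattice_isomorphic_iff_order_isomorphic
    by (intro conjI lattice_product lat partial_order_compact_opens exI[of _ ?F])
      (simp_all add: product_order_def compact_opens_def)
qed

section \<open>Finite products of commutative BCK-algebras\<close>

definition bck_product :: "'i set \<Rightarrow> ('i \<Rightarrow> ('a, 'm) bck_scheme) \<Rightarrow> ('i \<Rightarrow> 'a) bck"
  where "bck_product J A = \<lparr>carrier = (\<Pi>\<^sub>E j\<in>J. carrier (A j)),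
    bmul = (\<lambda>x y. \<lambda>j\<in>J. x j \<cdot>\<^bsub>A j\<^esub> y j), bzero = (\<lambda>j\<in>J. \<zero>\<^bsub>A j\<^esub>)\<rparr>"

locale finite_bck_family =
  fixes J :: "'i set" and A :: "'i \<Rightarrow> ('a, 'm) bck_scheme"
  assumes finite_index: "finite J"
    and bck: "j \<in> J \<Longrightarrow> commutative_bck (A j)"
begin

lemmas bck_simps = commutative_bck.mul_closed[OF bck] commutative_bck.zero_closed[OF bck]
  commutative_bck.mul_self[OF bck] commutative_bck.mul_zero[OF bck] commutative_bck.zero_mul[OF bck]

abbreviation product_algebra :: "('i \<Rightarrow> 'a) bck"  (\<open>\<Pi>A\<close>)
  where "\<Pi>A \<equiv> bck_product J A"

lemma product_simps:
  "x \<in> carrier \<Pi>A \<longleftrightarrow> x \<in> (\<Pi>\<^sub>E j\<in>J. carrier (A j))"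
  "x \<cdot>\<^bsub>\<Pi>A\<^esub> y = (\<lambda>j\<in>J. x j \<cdot>\<^bsub>A j\<^esub> y j)"
  "\<zero>\<^bsub>\<Pi>A\<^esub> = (\<lambda>j\<in>J. \<zero>\<^bsub>A j\<^esub>)"
  by (simp_all add: bck_product_def)

lemma product_mem: "\<lbrakk>x \<in> carrier \<Pi>A; j \<in> J\<rbrakk> \<Longrightarrow> x j \<in> carrier (A j)"
  by (auto simp: product_simps)

lemma product_bck: "commutative_bck \<Pi>A"
proof
  fix x y z assume "x \<in> carrier \<Pi>A" "y \<in> carrier \<Pi>A" "z \<in> carrier \<Pi>A"
  then show "(x \<cdot>\<^bsub>\<Pi>A\<^esub> y) \<cdot>\<^bsub>\<Pi>A\<^esub> z = (x \<cdot>\<^bsub>\<Pi>A\<^esub> z) \<cdot>\<^bsub>\<Pi>A\<^esub> y"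
    by (auto simp: product_simps PiE_iff commutative_bck.mul_right_comm[OF bck])
next
  fix x y assume "x \<in> carrier \<Pi>A" "y \<in> carrier \<Pi>A"
  then show "x \<cdot>\<^bsub>\<Pi>A\<^esub> (x \<cdot>\<^bsub>\<Pi>A\<^esub> y) = y \<cdot>\<^bsub>\<Pi>A\<^esub> (y \<cdot>\<^bsub>\<Pi>A\<^esub> x)"
    by (auto simp: product_simps PiE_iff commutative_bck.mul_mul_comm[OF bck])
qed (auto simp: product_simps PiE_iff bck_simps extensional_def)

lemma meet_component:
  "j \<in> J \<Longrightarrow> bck_meet \<Pi>A x y j = bck_meet (A j) (x j) (y j)"
  by (simp add: bck_meet_def product_simps)

definition single :: "'i \<Rightarrow> 'a \<Rightarrow> 'i \<Rightarrow> 'a"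
  where "single j a = (\<lambda>i\<in>J. if i = j then a else \<zero>\<^bsub>A i\<^esub>)"

lemma single_closed: "a \<in> carrier (A j) \<Longrightarrow> single j a \<in> carrier \<Pi>A"
  by (auto simp: single_def product_simps bck_simps)

lemma single_same: "j \<in> J \<Longrightarrow> single j a j = a"
  by (simp add: single_def)

lemma single_mul: "single j a \<cdot>\<^bsub>\<Pi>A\<^esub> single j b = single j (a \<cdot>\<^bsub>A j\<^esub> b)"
  by (auto simp: single_def product_simps bck_simps)

lemma single_zero: "single j \<zero>\<^bsub>A j\<^esub> = \<zero>\<^bsub>\<Pi>A\<^esub>"
  by (auto simp: single_def product_simps)

text \<open>
  The trace of \<open>I\<close> on the \<open>j\<close>-th factor, taken along the embedding rather than as a projection:
  membership in an inverse image is the easier one to verify, and for ideals the two agree.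
\<close>

definition component :: "'i \<Rightarrow> ('i \<Rightarrow> 'a) set \<Rightarrow> 'a set"
  where "component j I = {a \<in> carrier (A j). single j a \<in> I}"

lemma ideal_component:
  assumes I: "bck_ideal \<Pi>A I" and j: "j \<in> J"
  shows "bck_ideal (A j) (component j I)"
  unfolding bck_ideal_def
proof (intro conjI ballI impI)
  show "component j I \<subseteq> carrier (A j)"
    by (auto simp: component_def)
  show "\<zero>\<^bsub>A j\<^esub> \<in> component j I"
    using I j by (simp add: component_def single_zero bck_ideal_def bck_simps)
  fix a b
  assume ab: "a \<in> carrier (A j)" "b \<in> carrier (A j)"
    "a \<cdot>\<^bsub>A j\<^esub> b \<in> component j I \<and> b \<in> component j I"
  then have "single j a \<cdot>\<^bsub>\<Pi>A\<^esub> single j b \<in> I" "single j b \<in> I"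
    by (auto simp: component_def single_mul)
  then show "a \<in> component j I"
    using I ab single_closed unfolding bck_ideal_def component_def by blast
qed

text \<open>
  Every ideal of a finite product is a product of ideals. The embedded component of \<open>x\<close> lies below
  \<open>x\<close>, hence in every ideal that contains \<open>x\<close>. Conversely, \<open>x\<close> is built up from zero one index at a
  time: restoring the component at \<open>k\<close> is an instance of the ideal axiom, since multiplication by
  \<open>single k (x k)\<close> erases exactly that component. This is where the index set has to be finite; the
  elements of finite support form an ideal of an infinite product that may be proper although all
  its components are full.
\<close>

lemma mem_ideal_iff_components:
  assumes I: "bck_ideal \<Pi>A I" and x: "x \<in> carrier \<Pi>A"
  shows "x \<in> I \<longleftrightarrow> (\<forall>j\<in>J. x j \<in> component j I)"
proof
  assume "x \<in> I"
  show "\<forall>j\<in>J. x j \<in> component j I"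
  proof
    fix j assume j: "j \<in> J"
    have c: "single j (x j) \<in> carrier \<Pi>A"
      using single_closed product_mem[OF x j] by blast
    have "single j (x j) \<cdot>\<^bsub>\<Pi>A\<^esub> x = \<zero>\<^bsub>\<Pi>A\<^esub>"
      using product_mem[OF x] by (auto simp: single_def product_simps bck_simps)
    then have "single j (x j) \<in> I"
      using I x c \<open>x \<in> I\<close> unfolding bck_ideal_def by metis
    then show "x j \<in> component j I"
      using product_mem[OF x j] by (simp add: component_def)
  qed
next
  assume comp: "\<forall>j\<in>J. x j \<in> component j I"
  \<comment> \<open>The truncation of \<open>x\<close> to the indices in \<open>F\<close>.\<close>
  define t where "t F = (\<lambda>i\<in>J. if i \<in> F then x i else \<zero>\<^bsub>A i\<^esub>)" for F
  have t: "t F \<in> carrier \<Pi>A" for F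
    using product_mem[OF x] by (auto simp: t_def product_simps bck_simps)
  have "t F \<in> I" if "F \<subseteq> J" for F
    using finite_subset[OF that finite_index] that
  proof (induction F)
    case empty
    have "t {} = \<zero>\<^bsub>\<Pi>A\<^esub>"
      by (auto simp: t_def product_simps)
    then show ?case
      using I by (simp add: bck_ideal_def)
  next
    case (insert k F)
    have "t (insert k F) \<cdot>\<^bsub>\<Pi>A\<^esub> single k (x k) = t F"
      using product_mem[OF x] insert.hyps
      by (auto simp: t_def single_def product_simps bck_simps)
    moreover have "single k (x k) \<in> I"
      using comp insert.prems by (auto simp: component_def)
    moreover have "single k (x k) \<in> carrier \<Pi>A"
      using calculation(2) I by (auto simp: bck_ideal_def)
    ultimately show ?case
      using I t insert unfolding bck_ideal_def by (metis insert_subset)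
  qed
  moreover have "t J = x"
    using x by (auto simp: t_def product_simps PiE_iff extensional_def)
  ultimately show "x \<in> I"
    by blast
qed

section \<open>The spectrum of a finite product\<close>

definition cylinder :: "'i \<Rightarrow> 'a set \<Rightarrow> ('i \<Rightarrow> 'a) set"
  where "cylinder j P = {x \<in> carrier \<Pi>A. x j \<in> P}"

lemma prime_cylinder:
  assumes j: "j \<in> J" and P: "bck_prime_ideal (A j) P"
  shows "bck_prime_ideal \<Pi>A (cylinder j P)"
  unfolding bck_prime_ideal_def
proof (intro conjI ballI impI)
  have I: "bck_ideal (A j) P" 
    using P by (simp add: bck_prime_ideal_def)
  show "bck_ideal \<Pi>A (cylinder j P)"
    unfolding bck_ideal_def
  proof (intro conjI ballI impI)
    show "\<zero>\<^bsub>\<Pi>A\<^esub> \<in> cylinder j P"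
      using I j by (auto simp: cylinder_def product_simps bck_ideal_def bck_simps)
    fix x y assume xy: "x \<in> carrier \<Pi>A" "y \<in> carrier \<Pi>A"
      "x \<cdot>\<^bsub>\<Pi>A\<^esub> y \<in> cylinder j P \<and> y \<in> cylinder j P"
    then have "x j \<cdot>\<^bsub>A j\<^esub> y j \<in> P" "y j \<in> P"
      using j by (auto simp: cylinder_def product_simps)
    then have "x j \<in> P"
      using I product_mem[OF xy(1) j] product_mem[OF xy(2) j] unfolding bck_ideal_def by blast
    then show "x \<in> cylinder j P"
      using xy by (simp add: cylinder_def)
  qed (auto simp: cylinder_def)
  have "P \<noteq> carrier (A j)" "P \<subseteq> carrier (A j)"
    using P I by (simp_all add: bck_prime_ideal_def bck_ideal_def)
  then obtain a where "a \<in> carrier (A j)" "a \<notin> P"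
    by blast
  then have "single j a \<in> carrier \<Pi>A" "single j a \<notin> cylinder j P"
    by (simp_all add: single_closed cylinder_def single_same[OF j])
  then show "cylinder j P \<noteq> carrier \<Pi>A"
    by blast
  fix x y assume xy: "x \<in> carrier \<Pi>A" "y \<in> carrier \<Pi>A" "bck_meet \<Pi>A x y \<in> cylinder j P"
  then have "bck_meet (A j) (x j) (y j) \<in> P"
    by (simp add: cylinder_def meet_component[OF j])
  then have "x j \<in> P \<or> y j \<in> P"
    using P product_mem[OF xy(1) j] product_mem[OF xy(2) j] unfolding bck_prime_ideal_def by blast
  then show "x \<in> cylinder j P \<or> y \<in> cylinder j P"
    using xy by (simp add: cylinder_def)
qed

lemma component_cylinder:
  assumes "j \<in> J" "bck_prime_ideal (A j) P"
  shows "component j (cylinder j P) = P"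
  using assms
  by (auto simp: component_def cylinder_def single_same single_closed bck_prime_ideal_def bck_ideal_def)

text \<open>
  Some component of a prime ideal is proper, as the ideal itself is. All other components are full by
  primality, so membership depends on a single coordinate.
\<close>

lemma prime_ideal_is_cylinder:
  assumes P: "bck_prime_ideal \<Pi>A P"
  obtains j where "j \<in> J" "bck_prime_ideal (A j) (component j P)" "P = cylinder j (component j P)"
proof -
  have I: "bck_ideal \<Pi>A P"
    using P by (simp add: bck_prime_ideal_def)
  then obtain x where x: "x \<in> carrier \<Pi>A" "x \<notin> P"
    using P by (auto simp: bck_prime_ideal_def bck_ideal_def)
  then obtain j where j: "j \<in> J" "x j \<notin> component j P"
    using mem_ideal_iff_components[OF I] by blast
  have xj: "x j \<in> carrier (A j)" "single j (x j) \<notin> P"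
    using j product_mem[OF x(1)] by (auto simp: component_def)
  have other: "a \<in> component i P" if i: "i \<in> J" "i \<noteq> j" and a: "a \<in> carrier (A i)" for i a
  proof -
    \<comment> \<open>Elements with disjoint supports have meet zero, so a prime ideal contains one of them.\<close>
    have "bck_meet \<Pi>A (single i a) (single j (x j)) = \<zero>\<^bsub>\<Pi>A\<^esub>"
      using i j a xj by (auto simp: bck_meet_def product_simps single_def bck_simps)
    then have "bck_meet \<Pi>A (single i a) (single j (x j)) \<in> P"
      using I by (simp add: bck_ideal_def)
    then have "single i a \<in> P \<or> single j (x j) \<in> P"
      using P single_closed[OF a] single_closed[OF xj(1)] unfolding bck_prime_ideal_def by blast
    then show ?thesis
      using xj a by (simp add: component_def)
  qed
  have "y \<in> P \<longleftrightarrow> y \<in> cylinder j (component j P)" if "y \<in> carrier \<Pi>A" for y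
    using mem_ideal_iff_components[OF I that] that j other product_mem[OF that]
    by (auto simp: cylinder_def)
  moreover have "P \<subseteq> carrier \<Pi>A"
    using I by (simp add: bck_ideal_def)
  ultimately have "P = cylinder j (component j P)"
    by (auto simp: cylinder_def)
  moreover have "bck_prime_ideal (A j) (component j P)"
    unfolding bck_prime_ideal_def
  proof (intro conjI ballI impI)
    show "bck_ideal (A j) (component j P)"
      by (rule ideal_component[OF I j(1)])
    show "component j P \<noteq> carrier (A j)"
      using j xj by blast
    fix a b assume ab: "a \<in> carrier (A j)" "b \<in> carrier (A j)" "bck_meet (A j) a b \<in> component j P"
    then have "bck_meet \<Pi>A (single j a) (single j b) \<in> P"
      by (simp add: component_def bck_meet_def single_mul)
    then show "a \<in> component j P \<or> b \<in> component j P"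
      using P ab single_closed unfolding bck_prime_ideal_def component_def by blast
  qed
  ultimately show ?thesis
    using that j by blast
qed

lemma ideal_subset_cylinder_iff:
  assumes I: "bck_ideal \<Pi>A I" and j: "j \<in> J"
  shows "I \<subseteq> cylinder j P \<longleftrightarrow> component j I \<subseteq> P"
proof
  assume "I \<subseteq> cylinder j P"
  then show "component j I \<subseteq> P"
    using single_same[OF j] by (force simp: component_def cylinder_def)
next
  assume "component j I \<subseteq> P"
  moreover have "I \<subseteq> carrier \<Pi>A"
    using I by (simp add: bck_ideal_def)
  ultimately show "I \<subseteq> cylinder j P"
    using mem_ideal_iff_components[OF I] j by (auto simp: cylinder_def)
qed

text \<open>
  Forming cylinders pulls \<open>\<sigma>(I)\<close> back to \<open>\<sigma>\<close> of the component of \<open>I\<close>.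
\<close>

lemma continuous_map_cylinder:
  assumes j: "j \<in> J"
  shows "continuous_map (bck_spectrum (A j)) (bck_spectrum \<Pi>A) (cylinder j)"
  unfolding continuous_map_def
proof (intro conjI allI impI)
  show "cylinder j \<in> topspace (bck_spectrum (A j)) \<rightarrow> topspace (bck_spectrum \<Pi>A)"
    by (auto simp: commutative_bck.topspace_spectrum[OF bck[OF j]]
      commutative_bck.topspace_spectrum[OF product_bck] prime_cylinder[OF j])
  fix U assume "openin (bck_spectrum \<Pi>A) U"
  then obtain I where I: "bck_ideal \<Pi>A I" and U: "U = bck_sigma \<Pi>A I"
    by (auto simp: commutative_bck.openin_spectrum[OF product_bck])
  have "{P \<in> topspace (bck_spectrum (A j)). cylinder j P \<in> U} = bck_sigma (A j) (component j I)"
    by (auto simp: commutative_bck.topspace_spectrum[OF bck[OF j]] U bck_sigma_def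
      prime_cylinder[OF j] ideal_subset_cylinder_iff[OF I j])
  then show "openin (bck_spectrum (A j)) {P \<in> topspace (bck_spectrum (A j)). cylinder j P \<in> U}"
    using ideal_component[OF I j] by (auto simp: commutative_bck.openin_spectrum[OF bck[OF j]])
qed

text \<open>
  The image of \<open>\<sigma>(K)\<close> is \<open>\<sigma>(I)\<close>, where \<open>I\<close> is \<open>K\<close> embedded into the product: as \<open>I\<close> vanishes at
  every other index, the cylinders over other indices contain it and stay outside \<open>\<sigma>(I)\<close>.
\<close>

lemma open_map_cylinder:
  assumes j: "j \<in> J"
  shows "open_map (bck_spectrum (A j)) (bck_spectrum \<Pi>A) (cylinder j)"
  unfolding open_map_def
proof (intro allI impI)
  fix U assume "openin (bck_spectrum (A j)) U"
  then obtain K where K: "bck_ideal (A j) K" and U: "U = bck_sigma (A j) K"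
    by (auto simp: commutative_bck.openin_spectrum[OF bck[OF j]])
  define I where "I = single j ` K"
  have mem: "x \<in> I \<longleftrightarrow> x \<in> carrier \<Pi>A \<and> x j \<in> K \<and> (\<forall>i\<in>J-{j}. x i = \<zero>\<^bsub>A i\<^esub>)" for x
  proof
    assume "x \<in> I"
    then obtain a where "a \<in> K" "x = single j a"
      by (auto simp: I_def)
    with K j show "x \<in> carrier \<Pi>A \<and> x j \<in> K \<and> (\<forall>i\<in>J-{j}. x i = \<zero>\<^bsub>A i\<^esub>)"
      using single_closed[of a j] by (auto simp: single_def bck_ideal_def)
  next
    assume x: "x \<in> carrier \<Pi>A \<and> x j \<in> K \<and> (\<forall>i\<in>J-{j}. x i = \<zero>\<^bsub>A i\<^esub>)"
    then have "x = single j (x j)"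
      by (auto simp: single_def product_simps PiE_iff extensional_def)
    with x show "x \<in> I"
      by (auto simp: I_def)
  qed
  have I: "bck_ideal \<Pi>A I"
    unfolding bck_ideal_def
  proof (intro conjI ballI impI)
    show "I \<subseteq> carrier \<Pi>A"
      by (auto simp: mem)
    show "\<zero>\<^bsub>\<Pi>A\<^esub> \<in> I"
      using K j by (auto simp: mem product_simps bck_ideal_def bck_simps)
    fix x y assume xy: "x \<in> carrier \<Pi>A" "y \<in> carrier \<Pi>A" "x \<cdot>\<^bsub>\<Pi>A\<^esub> y \<in> I \<and> y \<in> I"
    have "x j \<cdot>\<^bsub>A j\<^esub> y j \<in> K" "y j \<in> K"
      using xy j by (auto simp: mem product_simps)
    then have "x j \<in> K"
      using K product_mem[OF xy(1) j] product_mem[OF xy(2) j] unfolding bck_ideal_def by blast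
    moreover have "x i = \<zero>\<^bsub>A i\<^esub>" if i: "i \<in> J - {j}" for i
    proof -
      have "x i \<cdot>\<^bsub>A i\<^esub> y i = \<zero>\<^bsub>A i\<^esub>" "y i = \<zero>\<^bsub>A i\<^esub>"
        using xy i by (auto simp: mem product_simps)
      then show ?thesis
        using i product_mem[OF xy(1), of i] by (simp add: bck_simps)
    qed
    ultimately show "x \<in> I"
      using xy by (simp add: mem)
  qed
  have "inj (single j)"
    by (rule injI) (metis single_same[OF j])
  then have comp: "component j I = K"
    using K by (auto simp: component_def I_def inj_image_mem_iff bck_ideal_def)
  have "cylinder j ` U = bck_sigma \<Pi>A I"
  proof
    show "cylinder j ` U \<subseteq> bck_sigma \<Pi>A I"
      by (auto simp: U bck_sigma_def prime_cylinder[OF j] ideal_subset_cylinder_iff[OF I j] comp)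
    show "bck_sigma \<Pi>A I \<subseteq> cylinder j ` U"
    proof
      fix P assume "P \<in> bck_sigma \<Pi>A I"
      then have P: "bck_prime_ideal \<Pi>A P" and ni: "\<not> I \<subseteq> P"
        by (auto simp: bck_sigma_def)
      from P obtain i where i: "i \<in> J" "bck_prime_ideal (A i) (component i P)"
        and Pi: "P = cylinder i (component i P)"
        by (rule prime_ideal_is_cylinder)
      have "i = j"
      proof (rule ccontr)
        assume "i \<noteq> j"
        \<comment> \<open>Every element of \<open>I\<close> vanishes at \<open>i\<close> and so belongs to every cylinder over \<open>i\<close>.\<close>
        then have "I \<subseteq> cylinder i (component i P)"
          using i by (auto simp: mem cylinder_def bck_prime_ideal_def bck_ideal_def)
        with ni Pi show False by simp
      qed
      with i Pi ni show "P \<in> cylinder j ` U"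
        using ideal_subset_cylinder_iff[OF I j, of "component j P"]
        by (auto simp: U bck_sigma_def comp)
    qed
  qed
  then show "openin (bck_spectrum \<Pi>A) (cylinder j ` U)"
    using I by (auto simp: commutative_bck.openin_spectrum[OF product_bck])
qed

lemma cylinders_disjoint:
  assumes i: "i \<in> J" and j: "j \<in> J" and ne: "i \<noteq> j"
    and P: "bck_prime_ideal (A i) P" and Q: "bck_prime_ideal (A j) Q"
  shows "cylinder i P \<noteq> cylinder j Q"
proof
  assume eq: "cylinder i P = cylinder j Q"
  obtain a where a: "a \<in> carrier (A i)" "a \<notin> P"
    using P by (auto simp: bck_prime_ideal_def bck_ideal_def)
  have "single i a \<in> cylinder j Q"
    using a j ne Q single_closed
    by (auto simp: cylinder_def single_def bck_prime_ideal_def bck_ideal_def)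
  then have "single i a \<in> cylinder i P"
    by (simp add: eq)
  then show False
    using a(2) by (simp add: cylinder_def single_same[OF i])
qed

theorem compact_opens_spectrum_product:
  assumes "\<And>j. j \<in> J \<Longrightarrow> Lattice.lattice (compact_opens (bck_spectrum (A j)))"
  shows "lattice_isomorphic (product_order J (\<lambda>j. compact_opens (bck_spectrum (A j))))
    (compact_opens (bck_spectrum \<Pi>A))"
proof (rule compact_opens_open_partition[OF finite_index, where f = cylinder])
  note top = commutative_bck.topspace_spectrum[OF bck]
  show "inj_on (cylinder j) (topspace (bck_spectrum (A j)))" if "j \<in> J" for j
    by (rule inj_on_inverseI[of _ "component j"]) (simp add: top that component_cylinder)
  show "disjoint_family_on (\<lambda>j. cylinder j ` topspace (bck_spectrum (A j))) J"
    using cylinders_disjoint by (fastforce simp: disjoint_family_on_def top)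
  show "topspace (bck_spectrum \<Pi>A) \<subseteq> (\<Union>j\<in>J. cylinder j ` topspace (bck_spectrum (A j)))"
  proof
    fix P assume "P \<in> topspace (bck_spectrum \<Pi>A)"
    then have "bck_prime_ideal \<Pi>A P"
      by (simp add: commutative_bck.topspace_spectrum[OF product_bck])
    then show "P \<in> (\<Union>j\<in>J. cylinder j ` topspace (bck_spectrum (A j)))"
      by (rule prime_ideal_is_cylinder) (auto simp: top)
  qed
qed (rule continuous_map_cylinder open_map_cylinder assms; assumption)+

end

section \<open>Products of representable lattices\<close>

theorem corollary5p14:
  fixes n :: nat
    and D :: "nat \<Rightarrow> 'd gorder"
  assumes "\<And>j. j \<in> {1..n} \<Longrightarrow> distributive_lattice (D j)"
    and "\<And>j. j \<in> {1..n} \<Longrightarrow>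
      \<exists>A :: 'a bck. commutative_bck A \<and>
        lattice_isomorphic (D j) (compact_opens (bck_spectrum A))"
  shows "\<exists>A :: (nat \<Rightarrow> 'a) bck. commutative_bck A \<and>
    lattice_isomorphic (product_order {1..n} D) (compact_opens (bck_spectrum A))"
proof -
  obtain A :: "nat \<Rightarrow> 'a bck" where A: "\<And>j. j \<in> {1..n} \<Longrightarrow> commutative_bck (A j)"
    and iso: "\<And>j. j \<in> {1..n} \<Longrightarrow> lattice_isomorphic (D j) (compact_opens (bck_spectrum (A j)))"
    using assms(2) by metis
  interpret finite_bck_family "{1..n}" A
    by (rule finite_bck_family.intro) (use A in auto)
  have "lattice_isomorphic (product_order {1..n} D)
      (product_order {1..n} (\<lambda>j. compact_opens (bck_spectrum (A j))))"
    using iso by (rule lattice_isomorphic_product)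
  moreover have "lattice_isomorphic (product_order {1..n} (\<lambda>j. compact_opens (bck_spectrum (A j))))
      (compact_opens (bck_spectrum (bck_product {1..n} A)))"
  proof (rule compact_opens_spectrum_product)
    show "Lattice.lattice (compact_opens (bck_spectrum (A j)))" if "j \<in> {1..n}" for j
      using iso[OF that] by (auto simp: lattice_isomorphic_def join_pres_def)
  qed
  ultimately have "lattice_isomorphic (product_order {1..n} D) (compact_opens (bck_spectrum (bck_product {1..n} A)))"
    by (rule lattice_isomorphic_trans)
  then show ?thesis
    using product_bck by blast
qed

end
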